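(* Let $J$ be a finite-dimensional unital Jordan algebra over $\mathbb{R}$ and let $M=J\otimes E$ be a free module over $J$, with $E$ a finite-dimensional real vector space. Then: 1. $\nabla^0=d\otimes\mathbb{I}_E:J\otimes E\rightarrow\Omega^1_{Der}(J)\otimes E$ defines a flat connection on $M$, which is gauge-invariant whenever the center of $J$ is trivial (that is, $Z(J)=\mathbb{R}1$). 2. Any other connection $\nabla$ on $M$ is defined by $$\nabla=\nabla^0+A:J\otimes E\rightarrow\Omega^1_{Der}(J)\otimes E,$$ where $A$ is a module homomorphism of $J\otimes E$ into $\Omega^1_{Der}(J)\otimes E$. 3. For a derivation-based connection $\nabla=\nabla^0+A$ the curvature is given by $$\nabla^2(X,Y)=R_{X,Y}=X(A(Y))-Y(A(X))+[A(X),A(Y)]-A([X,Y])$$ for any $X,Y\in Der(J)$. 4. If $J$ is a simple Jordan algebra, then $\nabla=\nabla^0+A$ defines a flat connection if and only if the map $A:Der(J)\rightarrow End(E)$ is a Lie algebra homomorphism.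
   Context: A (real) Jordan algebra is a real vector space $J$ with a bilinear commutative product satisfying $x(yx^2)=(xy)x^2$ for all $x,y\in J$; a unital Jordan algebra is simple if it is nonzero and its only ideals are $0$ and $J$. With $[x,y,z]=(xy)z-x(yz)$, its center $Z(J)$ is the set of $z\in J$ with $[x,y,z]=[x,z,y]=[z,x,y]=0$ for all $x,y\in J$. $Der(J)$ is the Lie algebra of derivations of $J$, i.e. linear maps $X:J\to J$ with $X(xy)=X(x)y+xX(y)$, under the commutator; it is a $Z(J)$-module by $(zX)(x)=zX(x)$, and derivations map $Z(J)$ into itself. $End(E)$ is the Lie algebra of linear endomorphisms of $E$ with the commutator, and $\mathbb{I}_E$ is the identity of $E$. A free $J$-module is $J\otimes E$ (tensor product over $\mathbb{R}$) with action $y(x\otimes e)=(yx)\otimes e$. A $J$-module homomorphism is a linear map $\varphi$ with $\varphi(xm)=x\varphi(m)$. $\Omega^1_{Der}(J)$ is the $J$-module of $Z(J)$-linear maps $Der(J)\to J$, and $d:J\to\Omega^1_{Der}(J)$ is $(dx)(X)=X(x)$. For a map $\nabla:J\otimes E\to\Omega^1_{Der}(J)\otimes E$ write $\nabla_X(m)=(\nabla m)(X)$, and for a module homomorphism $A:J\otimes E\to\Omega^1_{Der}(J)\otimes E$ write $A(X)(m)=(Am)(X)$. A derivation-based connection on a $J$-module $M$ is a linear map $X\mapsto\nabla_X$ from $Der(J)$ to the linear endomorphisms of $M$ such that $\nabla_X(xm)=X(x)m+x\nabla_Xm$ and $\nabla_{zX}(m)=z\nabla_X(m)$ for all $X\in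 Der(J)$, $x\in J$, $m\in M$, $z\in Z(J)$. "Connection" here means derivation-based connection. The curvature is $R_{X,Y}=[\nabla_X,\nabla_Y]-\nabla_{[X,Y]}$, also denoted $\nabla^2(X,Y)$; the connection is flat if $R_{X,Y}=0$ for all $X,Y\in Der(J)$. For a connection $\nabla=\nabla^0+A$ on $J\otimes E$, each $A(X)$ is a $J$-module endomorphism of $J\otimes E$ and is regarded as an element of $Z(J)\otimes End(E)$, acting by $(z\otimes T)(x\otimes e)=(zx)\otimes Te$. The expression $X(A(Y))$ means the derivation $X$ applied to the $Z(J)$ factor of $A(Y)\in Z(J)\otimes End(E)$. In item 4, $A$ is written as a map into $End(E)$, with $A(X)\in End(E)$ acting on $J\otimes E$ by $x\otimes e\mapsto x\otimes A(X)e$. A gauge transformation of $M$ is an invertible $J$-module endomorphism $U$ of $M$, acting on connections by $\nabla_X\mapsto U\circ\nabla_X\circ U^{-1}$; a connection is gauge-invariant if it is fixed by all gauge transformations. *)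

theory Defs
  imports "HOL-Analysis.Analysis" "HOL-Analysis.Finite_Function_Topology"
begin

section \<open>Tensor products of real vector spaces\<close>

text \<open>The tensor product is the free real vector space on pairs modulo the subspace spanned by
  the bilinearity relations. The vector space structure on finitely supported functions is the one
  from \<^theory>\<open>HOL-Analysis.Finite_Function_Topology\<close>.\<close>

abbreviation free_pair :: "'a \<Rightarrow> 'b \<Rightarrow> ('a \<times> 'b \<Rightarrow>\<^sub>0 real)"
  where "free_pair a b \<equiv> Poly_Mapping.single (a, b) 1"

definition tensor_relators :: "('a::real_vector \<times> 'b::real_vector \<Rightarrow>\<^sub>0 real) set"
  where "tensor_relators =
    {free_pair (a + a') b - free_pair a b - free_pair a' b | a a' b. True} \<union>
    {free_pair a (b + b') - free_pair a b - free_pair a b' | a b b'. True} \<union>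
    {free_pair (r *\<^sub>R a) b - r *\<^sub>R free_pair a b | r a b. True} \<union>
    {free_pair a (r *\<^sub>R b) - r *\<^sub>R free_pair a b | r a b. True}"

definition tensor_eq ::
    "('a::real_vector \<times> 'b::real_vector \<Rightarrow>\<^sub>0 real) \<Rightarrow> ('a \<times> 'b \<Rightarrow>\<^sub>0 real) \<Rightarrow> bool"
  where "tensor_eq p q \<longleftrightarrow> p - q \<in> span tensor_relators"

lemma equivp_tensor_eq: "equivp tensor_eq"
proof (rule equivpI)
  show "reflp tensor_eq"
    by (simp add: reflp_def tensor_eq_def span_zero)
  show "symp tensor_eq"
    unfolding symp_def tensor_eq_def by (metis minus_diff_eq span_neg)
  show "transp tensor_eq"
    unfolding transp_def tensor_eq_def
    by (metis (no_types, lifting) add_diff_cancel diff_add_cancel diff_diff_eq2 span_add)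
qed

quotient_type (overloaded) ('a, 'b) tensor =
    "('a::real_vector \<times> 'b::real_vector) \<Rightarrow>\<^sub>0 real" / tensor_eq
  by (rule equivp_tensor_eq)

instantiation tensor :: (real_vector, real_vector) real_vector
begin

lift_definition zero_tensor :: "('a, 'b) tensor" is 0 .

lift_definition plus_tensor :: "('a, 'b) tensor \<Rightarrow> ('a, 'b) tensor \<Rightarrow> ('a, 'b) tensor" is "(+)"
  unfolding tensor_eq_def by (metis add_diff_add span_add)

lift_definition minus_tensor :: "('a, 'b) tensor \<Rightarrow> ('a, 'b) tensor \<Rightarrow> ('a, 'b) tensor" is "(-)"
  unfolding tensor_eq_def
proof -
  fix p q r s :: "'a \<times> 'b \<Rightarrow>\<^sub>0 real"
  assume "p - q \<in> span tensor_relators" "r - s \<in> span tensor_relators"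
  then have "(p - q) - (r - s) \<in> span tensor_relators" by (rule span_diff)
  then show "(p - r) - (q - s) \<in> span tensor_relators" by (simp add: algebra_simps)
qed

lift_definition uminus_tensor :: "('a, 'b) tensor \<Rightarrow> ('a, 'b) tensor" is uminus
  unfolding tensor_eq_def
proof -
  fix p q :: "'a \<times> 'b \<Rightarrow>\<^sub>0 real"
  assume "p - q \<in> span tensor_relators"
  then have "- (p - q) \<in> span tensor_relators" by (rule span_neg)
  then show "- p - - q \<in> span tensor_relators" by simp
qed

lift_definition scaleR_tensor :: "real \<Rightarrow> ('a, 'b) tensor \<Rightarrow> ('a, 'b) tensor" is "(*\<^sub>R)"
  unfolding tensor_eq_def by (metis scaleR_diff_right span_scale)

instance
proof -
  have eq: "tensor_eq p q" if "p = q" for p q :: "'a \<times> 'b \<Rightarrow>\<^sub>0 real"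
    using that by (simp add: tensor_eq_def span_zero)
  show "OFCLASS(('a, 'b) tensor, real_vector_class)"
    by standard (transfer; rule eq; simp add: algebra_simps)+
qed

end

lift_definition tensor :: "'a::real_vector \<Rightarrow> 'b::real_vector \<Rightarrow> ('a, 'b) tensor"
    (infixl \<open>\<otimes>\<close> 70)
  is free_pair .

definition tensor_lift ::
    "('a::real_vector \<Rightarrow> 'b::real_vector \<Rightarrow> 'c::real_vector) \<Rightarrow> ('a, 'b) tensor \<Rightarrow> 'c"
  where "tensor_lift h = (THE \<phi>. linear \<phi> \<and> (\<forall>a b. \<phi> (a \<otimes> b) = h a b))"

lemma bilinear_tensor: "bilinear (\<otimes>)"
proof -
  have rel: "tensor_eq p q" if "p - q \<in> tensor_relators" for p q :: "'a \<times> 'b \<Rightarrow>\<^sub>0 real"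
    using that by (simp add: tensor_eq_def span_base)
  have 1: "(a + a') \<otimes> b = a \<otimes> b + a' \<otimes> b" for a a' :: 'a and b :: 'b
    by (transfer, rule rel) (force simp: tensor_relators_def diff_diff_eq)
  have 2: "a \<otimes> (b + b') = a \<otimes> b + a \<otimes> b'" for a :: 'a and b b' :: 'b
    by (transfer, rule rel) (force simp: tensor_relators_def diff_diff_eq)
  have 3: "(r *\<^sub>R a) \<otimes> b = r *\<^sub>R (a \<otimes> b)" for r and a :: 'a and b :: 'b
    by (transfer, rule rel) (force simp: tensor_relators_def)
  have 4: "a \<otimes> (r *\<^sub>R b) = r *\<^sub>R (a \<otimes> b)" for r and a :: 'a and b :: 'b
    by (transfer, rule rel) (force simp: tensor_relators_def)
  show "bilinear ((\<otimes>) :: 'a \<Rightarrow> 'b \<Rightarrow> _)"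
    by (simp add: bilinear_def linear_iff 1 2 3 4)
qed

definition free_lift :: "('a \<Rightarrow> 'b \<Rightarrow> 'c::real_vector) \<Rightarrow> ('a \<times> 'b \<Rightarrow>\<^sub>0 real) \<Rightarrow> 'c"
  where "free_lift h p =
    (\<Sum>k\<in>Poly_Mapping.keys p. Poly_Mapping.lookup p k *\<^sub>R h (fst k) (snd k))"

lemma lookup_scaleR: "Poly_Mapping.lookup (r *\<^sub>R p) k = r *\<^sub>R Poly_Mapping.lookup p k"
  for p :: "'k \<Rightarrow>\<^sub>0 'v::real_vector"
proof -
  have "finite {i. r *\<^sub>R Poly_Mapping.lookup p i \<noteq> 0}"
    by (rule finite_subset[OF _ finite_keys[of p]]) (auto simp: in_keys_iff)
  then show ?thesis
    by (simp add: scaleR_poly_mapping_def)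
qed

lemma free_lift_superset:
  assumes "finite S" "Poly_Mapping.keys p \<subseteq> S"
  shows "free_lift h p = (\<Sum>k\<in>S. Poly_Mapping.lookup p k *\<^sub>R h (fst k) (snd k))"
  unfolding free_lift_def
  by (rule sum.mono_neutral_left) (use assms in \<open>auto simp: in_keys_iff\<close>)

lemma linear_free_lift: "linear (free_lift (h :: 'a \<Rightarrow> 'b \<Rightarrow> 'c::real_vector))"
proof (rule linearI)
  fix p q :: "'a \<times> 'b \<Rightarrow>\<^sub>0 real"
  let ?S = "Poly_Mapping.keys p \<union> Poly_Mapping.keys q \<union> Poly_Mapping.keys (p + q)"
  have "finite ?S" by simp
  then show "free_lift h (p + q) = free_lift h p + free_lift h q"
    by (subst (1 2 3) free_lift_superset[of ?S])
       (auto simp: lookup_add scaleR_add_left sum.distrib)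
next
  fix r and p :: "'a \<times> 'b \<Rightarrow>\<^sub>0 real"
  let ?S = "Poly_Mapping.keys p \<union> Poly_Mapping.keys (r *\<^sub>R p)"
  have "finite ?S" by simp
  then show "free_lift h (r *\<^sub>R p) = r *\<^sub>R free_lift h p"
    by (subst (1 2) free_lift_superset[of ?S]) (auto simp: lookup_scaleR scaleR_sum_right)
qed

lemma free_lift_pair: "free_lift h (free_pair a b) = h a b"
  by (simp add: free_lift_def)

lemma free_lift_relators:
  assumes "bilinear h" "p \<in> span tensor_relators"
  shows "free_lift h p = 0"
proof -
  note l = linear_free_lift[of h]
  have "free_lift h q = 0" if "q \<in> tensor_relators" for q
    using that unfolding tensor_relators_def
    by (auto simp: linear_diff[OF l] linear_scale[OF l] free_lift_pair
        bilinear_ladd[OF assms(1)] bilinear_radd[OF assms(1)]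
        bilinear_lmul[OF assms(1)] bilinear_rmul[OF assms(1)])
  then show ?thesis
    using linear_eq_0_on_span[OF l _ assms(2)] by blast
qed

lemma span_free_pairs: "span {free_pair a b | a b. True} = UNIV"
proof -
  have "p \<in> span {free_pair a b | a b. True}" for p :: "'a \<times> 'b \<Rightarrow>\<^sub>0 real"
  proof -
    have "p = (\<Sum>k\<in>Poly_Mapping.keys p. Poly_Mapping.lookup p k *\<^sub>R Poly_Mapping.single k 1)"
      by (rule poly_mapping_eqI)
         (simp add: lookup_sum lookup_scaleR lookup_single when_def in_keys_iff if_distrib
           cong: if_cong)
    also have "\<dots> \<in> span {free_pair a b | a b. True}"
      by (intro span_sum span_scale span_base) auto
    finally show ?thesis .
  qed
  then show ?thesis by blast
qed

lemma span_tensors: "span {a \<otimes> b | a b. True} = UNIV"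
proof -
  have lin: "linear (abs_tensor :: ('a \<times> 'b \<Rightarrow>\<^sub>0 real) \<Rightarrow> ('a, 'b) tensor)"
    by (rule linearI) (simp_all add: plus_tensor.abs_eq scaleR_tensor.abs_eq)
  have "surj (abs_tensor :: ('a \<times> 'b \<Rightarrow>\<^sub>0 real) \<Rightarrow> ('a, 'b) tensor)"
    by (metis Quotient_abs_rep Quotient_tensor surjI)
  moreover have "abs_tensor ` {free_pair a b | (a::'a) (b::'b). True} = {a \<otimes> b | a b. True}"
    by (auto simp: tensor.abs_eq)
  ultimately show ?thesis
    using linear_span_image[OF lin, of "{free_pair a b | a b. True}"] span_free_pairs by metis
qed

text \<open>The universal property, which makes \<^const>\<open>tensor_lift\<close> meaningful.\<close>

lemma tensor_lift_unique_ex: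
  assumes "bilinear h"
  shows "\<exists>!\<phi>. linear \<phi> \<and> (\<forall>a b. \<phi> (a \<otimes> b) = h a b)"
proof (rule ex_ex1I)
  define \<phi> where "\<phi> t = free_lift h (rep_tensor t)" for t
  note l = linear_free_lift[of h]
  have abs: "\<phi> (abs_tensor p) = free_lift h p" for p
  proof -
    have "tensor_eq (rep_tensor (abs_tensor p)) p"
      by (metis Quotient_rel_abs2 Quotient_rep_abs Quotient_tensor equivp_tensor_eq equivp_reflp)
    then have "free_lift h (rep_tensor (abs_tensor p) - p) = 0"
      unfolding tensor_eq_def by (rule free_lift_relators[OF assms])
    then show ?thesis by (simp add: \<phi>_def linear_diff[OF l])
  qed
  have "linear \<phi>"
  proof (rule linearI)
    show "\<phi> (s + t) = \<phi> s + \<phi> t" for s t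
      by (induct s, induct t) (simp add: plus_tensor.abs_eq abs linear_add[OF l])
    show "\<phi> (r *\<^sub>R s) = r *\<^sub>R \<phi> s" for r s
      by (induct s) (simp add: scaleR_tensor.abs_eq abs linear_scale[OF l])
  qed
  moreover have "\<phi> (a \<otimes> b) = h a b" for a b
    by (simp add: tensor.abs_eq abs free_lift_pair)
  ultimately show "\<exists>\<phi>. linear \<phi> \<and> (\<forall>a b. \<phi> (a \<otimes> b) = h a b)" by blast
next
  fix \<phi> \<psi>
  assume *: "linear \<phi> \<and> (\<forall>a b. \<phi> (a \<otimes> b) = h a b)" "linear \<psi> \<and> (\<forall>a b. \<psi> (a \<otimes> b) = h a b)"
  show "\<phi> = \<psi>"
  proof
    fix t
    show "\<phi> t = \<psi> t"
      by (rule linear_eq_on_span[of \<phi> \<psi> "{a \<otimes> b | a b. True}"])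
         (use * span_tensors in auto)
  qed
qed

lemma
  assumes "bilinear h"
  shows linear_tensor_lift: "linear (tensor_lift h)"
    and tensor_lift_tensor: "tensor_lift h (a \<otimes> b) = h a b"
  using theI'[OF tensor_lift_unique_ex[OF assms]] unfolding tensor_lift_def by blast+

section \<open>Linear endomorphisms\<close>

definition finite_dim :: "'a::real_vector itself \<Rightarrow> bool"
  where "finite_dim _ \<longleftrightarrow> (\<exists>B::'a set. finite B \<and> span B = UNIV)"

typedef (overloaded) 'e endo = "{T :: 'e::real_vector \<Rightarrow> 'e. linear T}"
  morphisms endo_apply Endo
  using linear_id by blast

setup_lifting type_definition_endo

instantiation endo :: (real_vector) real_vector
begin
lift_definition zero_endo :: "'a endo" is "\<lambda>_. 0" by (simp add: linear_iff)
lift_definition plus_endo :: "'a endo \<Rightarrow> 'a endo \<Rightarrow> 'a endo" is "\<lambda>S T e. S e + T e"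
  by (simp add: linear_iff algebra_simps)
lift_definition minus_endo :: "'a endo \<Rightarrow> 'a endo \<Rightarrow> 'a endo" is "\<lambda>S T e. S e - T e"
  by (simp add: linear_iff algebra_simps)
lift_definition uminus_endo :: "'a endo \<Rightarrow> 'a endo" is "\<lambda>T e. - T e"
  by (simp add: linear_iff algebra_simps)
lift_definition scaleR_endo :: "real \<Rightarrow> 'a endo \<Rightarrow> 'a endo" is "\<lambda>r T e. r *\<^sub>R T e"
  by (simp add: linear_iff algebra_simps)
instance
  by standard (transfer; simp add: fun_eq_iff algebra_simps)+
end

lift_definition endo_bracket :: "'e::real_vector endo \<Rightarrow> 'e endo \<Rightarrow> 'e endo"
  is "\<lambda>S T e. S (T e) - T (S e)"
  by (simp add: linear_iff algebra_simps)

section \<open>Jordan algebras, their center and derivations\<close>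

class jordan_algebra = real_vector + times +
  assumes jordan_commute: "x * y = y * x"
    and jordan_add_left: "(x + y) * z = x * z + y * z"
    and jordan_scaleR_left: "(r *\<^sub>R x) * y = r *\<^sub>R (x * y)"
    and jordan_identity: "x * (y * (x * x)) = (x * y) * (x * x)"

class unital_jordan_algebra = jordan_algebra + one +
  assumes jordan_one_left: "1 * x = x"

lemma jordan_add_right: "x * (y + z) = x * y + x * z"
  for x y z :: "'j::jordan_algebra"
  by (metis jordan_add_left jordan_commute)

lemma jordan_scaleR_right: "x * (r *\<^sub>R y) = r *\<^sub>R (x * y)"
  for x y :: "'j::jordan_algebra"
  by (metis jordan_scaleR_left jordan_commute)

lemma linear_jordan_mult: "linear (\<lambda>x. y * x)" for y :: "'j::jordan_algebra"
  by (simp add: linear_iff jordan_add_right jordan_scaleR_right)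

lemmas jordan_zero_right = linear_0[OF linear_jordan_mult]
lemmas jordan_minus_right = linear_neg[OF linear_jordan_mult]
lemmas jordan_diff_right = linear_diff[OF linear_jordan_mult]

lemma jordan_zero_left: "0 * x = 0" for x :: "'j::jordan_algebra"
  by (metis jordan_commute jordan_zero_right)

lemma jordan_minus_left: "(- x) * y = - (x * y)" for x :: "'j::jordan_algebra"
  by (metis jordan_commute jordan_minus_right)

lemma jordan_diff_left: "(x - y) * z = x * z - y * z" for x :: "'j::jordan_algebra"
  by (metis jordan_commute jordan_diff_right)

lemmas jordan_bilinear = jordan_add_left jordan_add_right jordan_scaleR_left jordan_scaleR_right
  jordan_zero_left jordan_zero_right jordan_minus_left jordan_minus_right
  jordan_diff_left jordan_diff_right

definition jordan_ideal :: "'j::jordan_algebra set \<Rightarrow> bool"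
  where "jordan_ideal I \<longleftrightarrow> subspace I \<and> (\<forall>x. \<forall>a\<in>I. x * a \<in> I)"

definition simple_jordan :: "'j::unital_jordan_algebra itself \<Rightarrow> bool"
  where "simple_jordan _ \<longleftrightarrow>
    (UNIV :: 'j set) \<noteq> {0} \<and> (\<forall>I :: 'j set. jordan_ideal I \<longrightarrow> I = {0} \<or> I = UNIV)"

definition associator :: "'j::jordan_algebra \<Rightarrow> 'j \<Rightarrow> 'j \<Rightarrow> 'j"
  where "associator x y z = (x * y) * z - x * (y * z)"

definition jordan_center :: "'j::jordan_algebra set"
  where "jordan_center =
    {z. \<forall>x y. associator x y z = 0 \<and> associator x z y = 0 \<and> associator z x y = 0}"

definition trivial_center :: "'j::unital_jordan_algebra itself \<Rightarrow> bool"
  where "trivial_center _ \<longleftrightarrow> (jordan_center :: 'j set) = range (\<lambda>r. r *\<^sub>R 1)"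

typedef (overloaded) 'j center = "jordan_center :: 'j::jordan_algebra set"
  morphisms of_center Center
  by (rule exI[of _ 0]) (simp add: jordan_center_def associator_def jordan_bilinear)

setup_lifting type_definition_center

instantiation center :: (jordan_algebra) real_vector
begin
lift_definition zero_center :: "'a center" is 0
  by (simp add: jordan_center_def associator_def jordan_bilinear)
lift_definition plus_center :: "'a center \<Rightarrow> 'a center \<Rightarrow> 'a center" is "(+)"
  by (simp add: jordan_center_def associator_def jordan_bilinear)
lift_definition minus_center :: "'a center \<Rightarrow> 'a center \<Rightarrow> 'a center" is "(-)"
  by (simp add: jordan_center_def associator_def jordan_bilinear)
lift_definition uminus_center :: "'a center \<Rightarrow> 'a center" is uminus
  by (simp add: jordan_center_def associator_def jordan_bilinear)
lift_definition scaleR_center :: "real \<Rightarrow> 'a center \<Rightarrow> 'a center" is "(*\<^sub>R)"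
  by (simp add: jordan_center_def associator_def jordan_bilinear)
instance
  by standard (transfer; simp add: algebra_simps)+
end

typedef (overloaded) 'j der =
    "{X :: 'j::jordan_algebra \<Rightarrow> 'j. linear X \<and> (\<forall>x y. X (x * y) = X x * y + x * X y)}"
  morphisms der_apply Der
  by (rule exI[of _ "\<lambda>_. 0"]) (simp add: linear_iff jordan_bilinear)

setup_lifting type_definition_der

instantiation der :: (jordan_algebra) real_vector
begin
lift_definition zero_der :: "'a der" is "\<lambda>_. 0"
  by (simp add: linear_iff jordan_bilinear)
lift_definition plus_der :: "'a der \<Rightarrow> 'a der \<Rightarrow> 'a der" is "\<lambda>X Y x. X x + Y x"
  by (simp add: linear_iff jordan_bilinear algebra_simps)
lift_definition minus_der :: "'a der \<Rightarrow> 'a der \<Rightarrow> 'a der" is "\<lambda>X Y x. X x - Y x"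
  by (simp add: linear_iff jordan_bilinear algebra_simps)
lift_definition uminus_der :: "'a der \<Rightarrow> 'a der" is "\<lambda>X x. - X x"
  by (simp add: linear_iff jordan_bilinear algebra_simps)
lift_definition scaleR_der :: "real \<Rightarrow> 'a der \<Rightarrow> 'a der" is "\<lambda>r X x. r *\<^sub>R X x"
  by (simp add: linear_iff jordan_bilinear algebra_simps)
instance
  by standard (transfer; simp add: fun_eq_iff algebra_simps)+
end

lift_definition der_bracket :: "'j::jordan_algebra der \<Rightarrow> 'j der \<Rightarrow> 'j der"
  is "\<lambda>X Y x. X (Y x) - Y (X x)"
  by (simp add: linear_iff jordan_bilinear algebra_simps)

lift_definition center_der :: "'j::jordan_algebra center \<Rightarrow> 'j der \<Rightarrow> 'j der"
  is "\<lambda>z X x. z * X x"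
proof (intro conjI allI)
  fix z :: 'j and X :: "'j \<Rightarrow> 'j"
  assume z: "z \<in> jordan_center" and "linear X \<and> (\<forall>x y. X (x * y) = X x * y + x * X y)"
  then have X: "linear X" "X (x * y) = X x * y + x * X y" for x y by auto
  show "linear (\<lambda>x. z * X x)"
    using X(1) by (simp add: linear_iff jordan_bilinear)
  have c: "z * (a * b) = (z * a) * b" for a b
    using z by (simp add: jordan_center_def associator_def)
  show "z * X (x * y) = (z * X x) * y + x * (z * X y)" for x y
    by (simp add: X(2) jordan_add_right c) (metis c jordan_commute)
qed

lift_definition der_center :: "'j::jordan_algebra der \<Rightarrow> 'j center \<Rightarrow> 'j center"
  is "\<lambda>X z. X z"
proof -
  fix X :: "'j \<Rightarrow> 'j" and z :: 'j
  assume "linear X \<and> (\<forall>x y. X (x * y) = X x * y + x * X y)" and z: "z \<in> jordan_center"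
  then have X: "linear X" "X (x * y) = X x * y + x * X y" for x y by auto
  have ass: "X (associator a b c) = associator (X a) b c + associator a (X b) c + associator a b (X c)"
    for a b c
    by (simp add: associator_def linear_diff[OF X(1)] X(2) jordan_bilinear algebra_simps)
  have z': "associator x y z = 0" "associator x z y = 0" "associator z x y = 0" for x y
    using z by (auto simp: jordan_center_def)
  show "X z \<in> jordan_center"
    unfolding jordan_center_def
    using ass[of _ _ z] ass[of _ z] ass[of z] by (simp add: z' linear_0[OF X(1)])
qed

section \<open>One-forms and free modules\<close>

typedef (overloaded) 'j omega1 =
    "{\<omega> :: 'j::jordan_algebra der \<Rightarrow> 'j.
       linear \<omega> \<and> (\<forall>z X. \<omega> (center_der z X) = of_center z * \<omega> X)}"
  morphisms omega1_apply Omega1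
  by (rule exI[of _ "\<lambda>_. 0"]) (simp add: linear_iff jordan_bilinear)

setup_lifting type_definition_omega1

instantiation omega1 :: (jordan_algebra) real_vector
begin
lift_definition zero_omega1 :: "'a omega1" is "\<lambda>_. 0"
  by (simp add: linear_iff jordan_bilinear)
lift_definition plus_omega1 :: "'a omega1 \<Rightarrow> 'a omega1 \<Rightarrow> 'a omega1" is "\<lambda>\<omega> \<eta> X. \<omega> X + \<eta> X"
  by (simp add: linear_iff jordan_bilinear algebra_simps)
lift_definition minus_omega1 :: "'a omega1 \<Rightarrow> 'a omega1 \<Rightarrow> 'a omega1" is "\<lambda>\<omega> \<eta> X. \<omega> X - \<eta> X"
  by (simp add: linear_iff jordan_bilinear algebra_simps)
lift_definition uminus_omega1 :: "'a omega1 \<Rightarrow> 'a omega1" is "\<lambda>\<omega> X. - \<omega> X"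
  by (simp add: linear_iff jordan_bilinear algebra_simps)
lift_definition scaleR_omega1 :: "real \<Rightarrow> 'a omega1 \<Rightarrow> 'a omega1" is "\<lambda>r \<omega> X. r *\<^sub>R \<omega> X"
  by (simp add: linear_iff jordan_bilinear algebra_simps)
instance
  by standard (transfer; simp add: fun_eq_iff algebra_simps)+
end

lift_definition omega1_smult :: "'j::jordan_algebra \<Rightarrow> 'j omega1 \<Rightarrow> 'j omega1"
  is "\<lambda>x \<omega> X. x * \<omega> X"
proof (intro conjI allI)
  fix x :: 'j and \<omega> :: "'j der \<Rightarrow> 'j" and z :: "'j center" and X :: "'j der"
  assume *: "linear \<omega> \<and> (\<forall>z X. \<omega> (center_der z X) = of_center z * \<omega> X)"
  then show "linear (\<lambda>X. x * \<omega> X)"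
    by (simp add: linear_iff jordan_bilinear)
  have "of_center z * (a * b) = (of_center z * a) * b" for a b
    using of_center[of z] by (simp add: jordan_center_def associator_def)
  then show "x * \<omega> (center_der z X) = of_center z * (x * \<omega> X)"
    using * by (metis jordan_commute)
qed

lift_definition exterior_d :: "'j::jordan_algebra \<Rightarrow> 'j omega1"
  is "\<lambda>x X. der_apply X x"
  by (auto simp: linear_iff plus_der.rep_eq scaleR_der.rep_eq center_der.rep_eq)

definition free_smult ::
    "'j::jordan_algebra \<Rightarrow> ('j, 'e::real_vector) tensor \<Rightarrow> ('j, 'e) tensor"
  where "free_smult y = tensor_lift (\<lambda>x e. (y * x) \<otimes> e)"

definition omega1_free_smult ::
    "'j::jordan_algebra \<Rightarrow> ('j omega1, 'e::real_vector) tensor \<Rightarrow> ('j omega1, 'e) tensor"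
  where "omega1_free_smult y = tensor_lift (\<lambda>\<omega> e. omega1_smult y \<omega> \<otimes> e)"

definition eval_at ::
    "'j::jordan_algebra der \<Rightarrow> ('j omega1, 'e::real_vector) tensor \<Rightarrow> ('j, 'e) tensor"
  where "eval_at X = tensor_lift (\<lambda>\<omega> e. omega1_apply \<omega> X \<otimes> e)"

text \<open>\<open>along N X m\<close> is \<open>(N m)(X)\<close>, so it covers both \<open>\<nabla>\<^sub>X m\<close> and \<open>A(X) m\<close>.\<close>

definition along ::
    "(('j, 'e) tensor \<Rightarrow> ('j omega1, 'e) tensor) \<Rightarrow> 'j der \<Rightarrow>
     ('j::jordan_algebra, 'e::real_vector) tensor \<Rightarrow> ('j, 'e) tensor"
  where "along N X m = eval_at X (N m)"

section \<open>Connections\<close>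

text \<open>A module over \<^typ>\<open>'j\<close> is given by its action \<open>act\<close> on a real vector space.\<close>

definition jmodule_hom ::
    "('j \<Rightarrow> 'm \<Rightarrow> 'm) \<Rightarrow> ('j \<Rightarrow> 'n \<Rightarrow> 'n) \<Rightarrow> ('m::real_vector \<Rightarrow> 'n::real_vector) \<Rightarrow> bool"
  where "jmodule_hom act act' \<phi> \<longleftrightarrow> linear \<phi> \<and> (\<forall>x m. \<phi> (act x m) = act' x (\<phi> m))"

definition der_connection ::
    "('j \<Rightarrow> 'm \<Rightarrow> 'm) \<Rightarrow> ('j::jordan_algebra der \<Rightarrow> 'm \<Rightarrow> 'm::real_vector) \<Rightarrow> bool"
  where "der_connection act N \<longleftrightarrow>
    (\<forall>X. linear (N X)) \<and> (\<forall>m. linear (\<lambda>X. N X m)) \<and>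
    (\<forall>X x m. N X (act x m) = act (der_apply X x) m + act x (N X m)) \<and>
    (\<forall>z X m. N (center_der z X) m = act (of_center z) (N X m))"

definition commutator :: "('m \<Rightarrow> 'm) \<Rightarrow> ('m \<Rightarrow> 'm) \<Rightarrow> 'm \<Rightarrow> 'm::real_vector"
  where "commutator f g m = f (g m) - g (f m)"

definition curvature ::
    "('j::jordan_algebra der \<Rightarrow> 'm \<Rightarrow> 'm::real_vector) \<Rightarrow> 'j der \<Rightarrow> 'j der \<Rightarrow> 'm \<Rightarrow> 'm"
  where "curvature N X Y m = commutator (N X) (N Y) m - N (der_bracket X Y) m"

definition flat :: "('j::jordan_algebra der \<Rightarrow> 'm \<Rightarrow> 'm::real_vector) \<Rightarrow> bool"
  where "flat N \<longleftrightarrow> (\<forall>X Y m. curvature N X Y m = 0)"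

definition gauge_transformation :: "('j \<Rightarrow> 'm \<Rightarrow> 'm) \<Rightarrow> ('m::real_vector \<Rightarrow> 'm) \<Rightarrow> bool"
  where "gauge_transformation act U \<longleftrightarrow> jmodule_hom act act U \<and> bij U"

definition gauge_invariant ::
    "('j \<Rightarrow> 'm \<Rightarrow> 'm) \<Rightarrow> ('j::jordan_algebra der \<Rightarrow> 'm \<Rightarrow> 'm::real_vector) \<Rightarrow> bool"
  where "gauge_invariant act N \<longleftrightarrow>
    (\<forall>U. gauge_transformation act U \<longrightarrow> (\<forall>X. U \<circ> N X \<circ> inv U = N X))"

definition nabla0 ::
    "('j::jordan_algebra, 'e::real_vector) tensor \<Rightarrow> ('j omega1, 'e) tensor"
  where "nabla0 = tensor_lift (\<lambda>x e. exterior_d x \<otimes> e)"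

definition nabla ::
    "(('j, 'e) tensor \<Rightarrow> ('j omega1, 'e) tensor) \<Rightarrow>
     ('j::jordan_algebra, 'e::real_vector) tensor \<Rightarrow> ('j omega1, 'e) tensor"
  where "nabla A m = nabla0 m + A m"

section \<open>Connection forms with values in \<open>Z(J) \<otimes> End(E)\<close> and in \<open>End(E)\<close>\<close>

text \<open>\<open>(z \<otimes> T)(x \<otimes> e) = (z x) \<otimes> T e\<close>, extended linearly in both arguments.\<close>

definition center_endo_act ::
    "('j::jordan_algebra center, 'e::real_vector endo) tensor \<Rightarrow>
     ('j, 'e) tensor \<Rightarrow> ('j, 'e) tensor"
  where "center_endo_act a m =
    tensor_lift (\<lambda>z T. tensor_lift (\<lambda>x e. (of_center z * x) \<otimes> endo_apply T e) m) a"

definition der_center_endo ::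
    "'j::jordan_algebra der \<Rightarrow> ('j center, 'e::real_vector endo) tensor \<Rightarrow>
     ('j center, 'e endo) tensor"
  where "der_center_endo X = tensor_lift (\<lambda>z T. der_center X z \<otimes> T)"

definition center_endo_form ::
    "(('j, 'e) tensor \<Rightarrow> ('j omega1, 'e) tensor) \<Rightarrow>
     ('j::jordan_algebra der \<Rightarrow> ('j center, 'e::real_vector endo) tensor) \<Rightarrow> bool"
  where "center_endo_form A \<alpha> \<longleftrightarrow> (\<forall>X m. along A X m = center_endo_act (\<alpha> X) m)"

text \<open>The case \<open>A(X) \<in> 1 \<otimes> End(E)\<close>. It is automatic when the center is the real line, but not
  for every simple algebra: the center of a complex simple algebra regarded as a real one is the
  complex field.\<close>

definition endo_form ::
    "(('j, 'e) tensor \<Rightarrow> ('j omega1, 'e) tensor) \<Rightarrow>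
     ('j::jordan_algebra der \<Rightarrow> 'e::real_vector endo) \<Rightarrow> bool"
  where "endo_form A T \<longleftrightarrow> (\<forall>X x e. along A X (x \<otimes> e) = x \<otimes> endo_apply (T X) e)"

definition der_endo_lie_hom ::
    "('j::jordan_algebra der \<Rightarrow> 'e::real_vector endo) \<Rightarrow> bool"
  where "der_endo_lie_hom T \<longleftrightarrow>
    linear T \<and> (\<forall>X Y. T (der_bracket X Y) = endo_bracket (T X) (T Y))"

end

theory Submission
  imports Defs
begin

text \<open>
  Everything rests on one observation about the free module \<open>J \<otimes> E\<close>: its \<open>J\<close>-module
  endomorphisms are matrices over the center. An endomorphism \<open>U\<close> is determined by the values
  \<open>U (1 \<otimes> e)\<close>, since \<open>U (x \<otimes> e) = x U (1 \<otimes> e)\<close>. A product of two elements of \<open>J\<close> need not act as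
  the composite of their actions, but on \<open>1 \<otimes> e\<close> it does; applying \<open>U\<close>, each coordinate \<open>u\<close> of
  \<open>U (1 \<otimes> e)\<close> satisfies \<open>x (y u) = (x y) u\<close>, and by commutativity this puts \<open>u\<close> in the center
  (\<open>coord_jmodule_hom_center\<close>). As \<open>E\<close> has a finite basis, the endomorphisms are thereby identified
  with \<open>Z(J) \<otimes> End(E)\<close> (\<open>jmodule_hom_eq_center_endo_act\<close>, \<open>center_endo_act_inject\<close>).

  The four claims follow. In coordinates \<open>\<nabla>\<^sup>0\<close> applies the derivation \<open>X\<close> to each coordinate, so it is
  a flat connection; if the center is the real line, gauge transformations are real matrices, whose
  entries derivations annihilate, and they commute with \<open>\<nabla>\<^sup>0\<close> (\<open>gauge_invariant_nabla0\<close>). Two connections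
  differ by a \<open>J\<close>-linear map for each \<open>X\<close>, because the Leibniz terms cancel, and its coordinates are
  one-forms in \<open>X\<close> (\<open>one_form_of_family\<close>). The curvature formula is the flatness of \<open>\<nabla>\<^sup>0\<close> together
  with the fact that the commutator of \<open>\<nabla>\<^sup>0\<^sub>X\<close> with an element of \<open>Z(J) \<otimes> End(E)\<close> differentiates the
  central factor (\<open>along_nabla0_center_endo_act\<close>). When \<open>A\<close> takes values in \<open>End(E)\<close> the
  derivative terms vanish, the curvature of \<open>x \<otimes> e\<close> is \<open>x \<otimes> ([A X, A Y] - A [X, Y]) e\<close>, and
  taking \<open>x = 1\<close>, which is nonzero in a simple algebra, shows that flatness is the homomorphism
  property (\<open>flat_iff_lie_hom\<close>).
\<close>

section \<open>Linear maps on tensor products\<close>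

lemmas tensor_bilinear =
  bilinear_ladd[OF bilinear_tensor] bilinear_radd[OF bilinear_tensor]
  bilinear_lsub[OF bilinear_tensor] bilinear_rsub[OF bilinear_tensor]
  bilinear_lmul[OF bilinear_tensor] bilinear_rmul[OF bilinear_tensor]
  bilinear_lzero[OF bilinear_tensor] bilinear_rzero[OF bilinear_tensor]

text \<open>Scalar multiples need no case of their own, since a scalar is absorbed into the first factor
  of a pure tensor.\<close>

lemma tensor_induct [case_names tensor add]:
  assumes tensor: "\<And>a b. P (a \<otimes> b)"
    and add: "\<And>s t. P s \<Longrightarrow> P t \<Longrightarrow> P (s + t)"
  shows "P t"
proof -
  have "t \<in> span {a \<otimes> b | a b. True}"
    using span_tensors by auto
  then show ?thesis
  proof (induction rule: span_induct_alt)
    case base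
    show ?case
      using tensor[of 0 0] by (simp add: tensor_bilinear)
  next
    case (step r s t)
    then obtain a b where "r *\<^sub>R s = (r *\<^sub>R a) \<otimes> b"
      by (auto simp: tensor_bilinear)
    then show ?case
      using step add tensor by metis
  qed
qed

lemma linear_tensor_right: "linear (\<lambda>b. a \<otimes> b)"
  by (simp add: linear_iff tensor_bilinear)

lemma linear_ident: "linear (\<lambda>x. x)"
  by (simp add: linear_iff)

lemma bilinear_tensor_map:
  assumes "linear f" "linear g"
  shows "bilinear (\<lambda>a b. f a \<otimes> g b)"
  using assms by (simp add: bilinear_def linear_iff tensor_bilinear)

text \<open>A universal-property map depends linearly on any parameter on which its bilinear map depends
  linearly. This gives the linearity in \<open>X\<close> of \<open>(N m)(X)\<close>, and the linearity of the
  action of \<open>Z(J) \<otimes> End(E)\<close> in its central and endomorphism factors.\<close>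

lemma linear_tensor_lift_param:
  assumes "\<And>s. bilinear (h s)" "\<And>a b. linear (\<lambda>s. h s a b)"
  shows "linear (\<lambda>s. tensor_lift (h s) t)"
proof (induction t rule: tensor_induct)
  case (tensor a b)
  then show ?case
    by (simp add: assms tensor_lift_tensor)
next
  case (add s t)
  then show ?case
    by (simp add: linear_add[OF linear_tensor_lift[OF assms(1)]] linear_compose_add)
qed

section \<open>The modules \<open>J \<otimes> E\<close> and \<open>\<Omega>\<^sup>1 \<otimes> E\<close>\<close>

lemma free_smult_bilinear: "bilinear (\<lambda>x e. (y * x) \<otimes> e)" for y :: "'j::jordan_algebra"
  by (rule bilinear_tensor_map[OF linear_jordan_mult linear_ident])

lemma free_smult_tensor: "free_smult y (x \<otimes> e) = (y * x) \<otimes> e"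
  by (simp add: free_smult_def tensor_lift_tensor free_smult_bilinear)

lemma linear_free_smult: "linear (free_smult y)"
  unfolding free_smult_def by (rule linear_tensor_lift[OF free_smult_bilinear])

lemma omega1_smult_bilinear: "bilinear (\<lambda>\<omega> e. omega1_smult y \<omega> \<otimes> e)"
proof -
  have "linear (omega1_smult y)"
    by (rule linearI; transfer) (simp_all add: jordan_bilinear)
  then show ?thesis
    by (rule bilinear_tensor_map[OF _ linear_ident])
qed

lemma omega1_free_smult_tensor: "omega1_free_smult y (\<omega> \<otimes> e) = omega1_smult y \<omega> \<otimes> e"
  by (simp add: omega1_free_smult_def tensor_lift_tensor omega1_smult_bilinear)

lemma linear_omega1_free_smult: "linear (omega1_free_smult y)"
  unfolding omega1_free_smult_def by (rule linear_tensor_lift[OF omega1_smult_bilinear])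

lemma eval_at_bilinear: "bilinear (\<lambda>\<omega> e. omega1_apply \<omega> X \<otimes> e)"
  by (rule bilinear_tensor_map[OF _ linear_ident])
     (simp add: linear_iff plus_omega1.rep_eq scaleR_omega1.rep_eq)

lemma eval_at_tensor: "eval_at X (\<omega> \<otimes> e) = omega1_apply \<omega> X \<otimes> e"
  by (simp add: eval_at_def tensor_lift_tensor eval_at_bilinear)

lemma linear_eval_at: "linear (eval_at X)"
  unfolding eval_at_def by (rule linear_tensor_lift[OF eval_at_bilinear])

lemma linear_omega1_apply: "linear (omega1_apply \<omega>)"
  using omega1_apply[of \<omega>] by simp

lemma linear_eval_at_der: "linear (\<lambda>X. eval_at X t)"
  unfolding eval_at_def
proof (rule linear_tensor_lift_param[OF eval_at_bilinear])
  fix \<omega> :: "'j::jordan_algebra omega1" and e :: "'e::real_vector"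
  show "linear (\<lambda>X. omega1_apply \<omega> X \<otimes> e)"
    using linear_omega1_apply[of \<omega>] by (simp add: linear_iff tensor_bilinear)
qed

lemma eval_at_center_der:
  "eval_at (center_der z X) t = free_smult (of_center z) (eval_at X t)"
proof (induction t rule: tensor_induct)
  case (tensor \<omega> e)
  then show ?case
    using omega1_apply[of \<omega>] by (simp add: eval_at_tensor free_smult_tensor)
qed (simp add: linear_add[OF linear_eval_at] linear_add[OF linear_free_smult])

lemma eval_at_smult:
  "eval_at X (omega1_free_smult x t) = free_smult x (eval_at X t)"
proof (induction t rule: tensor_induct)
  case (tensor \<omega> e)
  then show ?case
    by (simp add: omega1_free_smult_tensor eval_at_tensor free_smult_tensor omega1_smult.rep_eq)
qed (simp add: linear_add[OF linear_eval_at] linear_add[OF linear_free_smult]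
      linear_add[OF linear_omega1_free_smult])

lemma linear_along: "linear A \<Longrightarrow> linear (along A X)"
  using linear_compose[OF _ linear_eval_at, of A X] by (simp add: o_def along_def[abs_def])

lemma linear_along_der: "linear (\<lambda>X. along A X m)"
  unfolding along_def by (rule linear_eval_at_der)

lemma along_center_der: "along A (center_der z X) m = free_smult (of_center z) (along A X m)"
  unfolding along_def by (rule eval_at_center_der)

text \<open>Evaluation of one-forms at \<open>X\<close> is \<open>J\<close>-linear, which turns a homomorphism into
  \<open>\<Omega>\<^sup>1 \<otimes> E\<close> into a family of endomorphisms of \<open>J \<otimes> E\<close> indexed by derivations.\<close>

lemma jmodule_hom_along:
  assumes "jmodule_hom free_smult omega1_free_smult A"
  shows "jmodule_hom free_smult free_smult (along A X)"
  using assms linear_along[of A X] by (simp add: jmodule_hom_def along_def eval_at_smult)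

section \<open>The canonical connection and its translates\<close>

lemma linear_der_apply: "linear (der_apply X)"
  and der_apply_mult: "der_apply X (x * y) = der_apply X x * y + x * der_apply X y"
  using der_apply[of X] by auto

lemma der_apply_one: "der_apply X (1::'j::unital_jordan_algebra) = 0"
  using der_apply_mult[of X "1::'j" 1] jordan_commute[of "der_apply X (1::'j)" 1]
  by (simp add: jordan_one_left)

lemma nabla0_bilinear:
  "bilinear (\<lambda>x e. exterior_d x \<otimes> e :: ('j::jordan_algebra omega1, 'e::real_vector) tensor)"
proof -
  have "linear (exterior_d :: 'j \<Rightarrow> 'j omega1)"
    by (rule linearI; transfer)
       (simp_all add: linear_add[OF linear_der_apply] linear_scale[OF linear_der_apply])
  then show ?thesis
    by (rule bilinear_tensor_map[OF _ linear_ident])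
qed

lemma linear_along_nabla0: "linear (along nabla0 X)"
  unfolding nabla0_def by (rule linear_along[OF linear_tensor_lift[OF nabla0_bilinear]])

lemma along_nabla0_tensor: "along nabla0 X (x \<otimes> e) = der_apply X x \<otimes> e"
  by (simp add: along_def nabla0_def tensor_lift_tensor nabla0_bilinear eval_at_tensor
      exterior_d.rep_eq)

text \<open>On a pure tensor this is the product rule for \<open>X\<close>, applied to the factor in \<open>J\<close>.\<close>

lemma along_nabla0_Leibniz:
  "along nabla0 X (free_smult y m) =
    free_smult (der_apply X y) m + free_smult y (along nabla0 X m)"
proof (induction m rule: tensor_induct)
  case (tensor x e)
  then show ?case
    by (simp add: along_nabla0_tensor free_smult_tensor der_apply_mult tensor_bilinear)
qed (simp add: linear_add[OF linear_free_smult] linear_add[OF linear_along_nabla0])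

lemma der_connection_nabla0: "der_connection free_smult (along nabla0)"
  unfolding der_connection_def
  by (simp add: linear_along_nabla0 linear_along_der along_nabla0_Leibniz along_center_der)

text \<open>The bracket of derivations is their commutator, and \<open>\<nabla>\<^sup>0\<^sub>X\<close> is \<open>X\<close> tensored with the identity of \<open>E\<close>.\<close>

lemma curvature_nabla0: "curvature (along nabla0) X Y m = 0"
proof (induction m rule: tensor_induct)
  case (tensor x e)
  then show ?case
    by (simp add: curvature_def commutator_def along_nabla0_tensor der_bracket.rep_eq
        tensor_bilinear)
next
  case (add s t)
  have "curvature (along nabla0) X Y (s + t)
      = curvature (along nabla0) X Y s + curvature (along nabla0) X Y t"
    by (simp add: curvature_def commutator_def linear_add[OF linear_along_nabla0])
  with add show ?case by simp
qed

lemma along_nabla: "along (nabla A) X m = along nabla0 X m + along A X m"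
  by (simp add: along_def nabla_def linear_add[OF linear_eval_at])

text \<open>\<open>J\<close>-linearity of \<open>A\<close> is what lets it be added without disturbing the Leibniz rule.\<close>

lemma der_connection_nabla:
  assumes "jmodule_hom free_smult omega1_free_smult A"
  shows "der_connection free_smult (along (nabla A))"
proof -
  have hom: "linear (along A X)" "along A X (free_smult y m) = free_smult y (along A X m)" for X y m
    using jmodule_hom_along[OF assms, of X] by (auto simp: jmodule_hom_def)
  have "linear (along (nabla A) X)" for X
    using linear_compose_add[OF linear_along_nabla0 hom(1), of X X]
    by (simp add: along_nabla[abs_def])
  then show ?thesis
    unfolding der_connection_def
    using linear_along_der[of "nabla A"] along_center_der[of "nabla A"]
    by (simp add: along_nabla along_nabla0_Leibniz hom linear_add[OF linear_free_smult] add.assoc)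
qed

section \<open>Coordinates\<close>

text \<open>Linear coefficient functions that express every vector through a finite set, such as a basis
  with its dual basis. Coefficients along a frame determine an object, since it can be reassembled
  from them; all uniqueness statements about tensors and endomorphisms are obtained in this way.\<close>

locale dual_frame =
  fixes B :: "'e::real_vector set" and c :: "'e \<Rightarrow> 'e \<Rightarrow> real"
  assumes finite_frame: "finite B"
    and linear_coefficient: "linear (c b)"
    and frame_expansion: "(\<Sum>b\<in>B. c b e *\<^sub>R b) = e"

lemma dual_frame_exists:
  assumes "finite_dim TYPE('e::real_vector)"
  shows "\<exists>(B::'e set) c. dual_frame B c"
proof -
  obtain S :: "'e set" where S: "finite S" "span S = UNIV"
    using assms by (auto simp: finite_dim_def)
  obtain B where B: "B \<subseteq> S" "independent B" "S \<subseteq> span B"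
    using real_vector.maximal_independent_subset[of S] by blast
  have fin: "finite B"
    using B(1) S(1) finite_subset by blast
  have span: "span B = UNIV"
    using span_minimal[OF B(3) subspace_span] S(2) by auto
  have "dual_frame B (\<lambda>b e. representation B e b)"
  proof (rule dual_frame.intro)
    show "linear (\<lambda>e. representation B e b)" for b
      by (rule linearI) (simp_all add: representation_add representation_scale B(2) span)
    show "(\<Sum>b\<in>B. representation B e b *\<^sub>R b) = e" for e
      using sum_representation_eq[OF B(2) _ fin, of e] span by simp
  qed (rule fin)
  then show ?thesis by blast
qed

context dual_frame
begin

definition coord :: "'e \<Rightarrow> ('v::real_vector, 'e) tensor \<Rightarrow> 'v"
  where "coord b = tensor_lift (\<lambda>v e. c b e *\<^sub>R v)"

lemma coord_bilinear: "bilinear (\<lambda>v e. c b e *\<^sub>R v)"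
  using linear_coefficient[of b] by (simp add: bilinear_def linear_iff algebra_simps)

lemma coord_tensor: "coord b (v \<otimes> e) = c b e *\<^sub>R v"
  unfolding coord_def by (rule tensor_lift_tensor[OF coord_bilinear])

lemma linear_coord: "linear (coord b)"
  unfolding coord_def by (rule linear_tensor_lift[OF coord_bilinear])

text \<open>A tensor in \<open>V \<otimes> E\<close> is a tuple of elements of \<open>V\<close>. Identities between tensors are thereby
  reduced to identities in \<open>V\<close>.\<close>

lemma coord_expansion: "(\<Sum>b\<in>B. coord b t \<otimes> b) = t"
proof (induction t rule: tensor_induct)
  case (tensor v e)
  have "(\<Sum>b\<in>B. coord b (v \<otimes> e) \<otimes> b) = (\<Sum>b\<in>B. v \<otimes> (c b e *\<^sub>R b))"
    by (simp add: coord_tensor tensor_bilinear)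
  also have "\<dots> = v \<otimes> (\<Sum>b\<in>B. c b e *\<^sub>R b)"
    by (rule linear_sum[OF linear_tensor_right, symmetric])
  finally show ?case by (simp add: frame_expansion)
qed (simp add: linear_add[OF linear_coord] tensor_bilinear sum.distrib)

lemma coord_free_smult: "coord b (free_smult y m) = y * coord b m"
  by (induction m rule: tensor_induct)
     (simp_all add: free_smult_tensor coord_tensor jordan_scaleR_right jordan_add_right
       linear_add[OF linear_coord] linear_add[OF linear_free_smult])

end

section \<open>Module endomorphisms\<close>

lemma jordan_one_right: "x * 1 = x" for x :: "'j::unital_jordan_algebra"
  by (metis jordan_commute jordan_one_left)

text \<open>In a commutative algebra the vanishing of one of the three associators with \<open>u\<close> forces
  that of the other two: \<open>[u, x, y]\<close> is \<open>- [y, x, u]\<close>, and \<open>[x, u, y]\<close> is \<open>y (x u) - x (y u)\<close>,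
  both terms of which are \<open>(x y) u\<close>.\<close>

lemma jordan_centerI:
  assumes "\<And>x y. x * (y * u) = (x * y) * u"
  shows "u \<in> jordan_center"
proof -
  have "associator x y u = 0" for x y
    by (simp add: associator_def assms)
  moreover have "associator x u y = 0" for x y
    unfolding associator_def
    by (metis assms jordan_commute right_minus_eq)
  moreover have "associator u x y = 0" for x y
    unfolding associator_def
    by (metis assms jordan_commute right_minus_eq)
  ultimately show ?thesis
    by (simp add: jordan_center_def)
qed

lemma jmodule_hom_tensor:
  fixes U :: "('j::unital_jordan_algebra, 'e::real_vector) tensor \<Rightarrow> ('j, 'e) tensor"
  assumes "jmodule_hom free_smult free_smult U"
  shows "U (x \<otimes> e) = free_smult x (U (1 \<otimes> e))"
proof -
  have "x \<otimes> e = free_smult x (1 \<otimes> e)"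
    by (simp add: free_smult_tensor jordan_one_right)
  then show ?thesis
    using assms by (simp add: jmodule_hom_def)
qed

text \<open>Computing \<open>U (x (y \<otimes> e))\<close> by moving \<open>x\<close> and \<open>y\<close> out one after the other, or the product
  \<open>x y\<close> at once, shows that \<open>U (1 \<otimes> e)\<close> associates with all \<open>x\<close> and \<open>y\<close>.\<close>

lemma (in dual_frame) coord_jmodule_hom_center:
  fixes U :: "('j::unital_jordan_algebra, 'e) tensor \<Rightarrow> ('j, 'e) tensor"
  assumes "jmodule_hom free_smult free_smult U"
  shows "coord b (U (1 \<otimes> e)) \<in> jordan_center"
proof (rule jordan_centerI)
  fix x y :: 'j
  have "free_smult x (free_smult y (U (1 \<otimes> e))) = U (free_smult x (y \<otimes> e))"
    using assms jmodule_hom_tensor[OF assms, of y e] by (simp add: jmodule_hom_def)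
  also have "\<dots> = free_smult (x * y) (U (1 \<otimes> e))"
    by (simp add: free_smult_tensor jmodule_hom_tensor[OF assms, of "x * y"])
  finally have "coord b (free_smult x (free_smult y (U (1 \<otimes> e))))
      = coord b (free_smult (x * y) (U (1 \<otimes> e)))"
    by simp
  then show "x * (y * coord b (U (1 \<otimes> e))) = (x * y) * coord b (U (1 \<otimes> e))"
    by (simp add: coord_free_smult)
qed

text \<open>With trivial center the coordinates of \<open>U (1 \<otimes> e)\<close> are real multiples of \<open>1\<close>, so
  \<open>\<nabla>\<^sup>0\<close> annihilates \<open>U (1 \<otimes> e)\<close>. By the Leibniz rule, \<open>\<nabla>\<^sup>0\<close> applied to \<open>U (x \<otimes> e) = x U (1 \<otimes> e)\<close>
  then differentiates only \<open>x\<close>, that is, \<open>U\<close> and \<open>\<nabla>\<^sup>0\<close> commute.\<close>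

lemma (in dual_frame) gauge_invariant_nabla0:
  assumes "trivial_center TYPE('j::unital_jordan_algebra)"
  shows "gauge_invariant free_smult (along (nabla0 :: ('j, 'e) tensor \<Rightarrow> ('j omega1, 'e) tensor))"
  unfolding gauge_invariant_def
proof (intro allI impI)
  fix U :: "('j, 'e) tensor \<Rightarrow> ('j, 'e) tensor" and X :: "'j der"
  assume "gauge_transformation free_smult U"
  then have U: "jmodule_hom free_smult free_smult U" and "bij U"
    by (auto simp: gauge_transformation_def)
  then have lin: "linear U"
    by (simp add: jmodule_hom_def)
  have const: "along nabla0 X (U (1 \<otimes> e)) = 0" for e
  proof -
    have zero: "along nabla0 X (coord b (U (1 \<otimes> e)) \<otimes> b) = 0" for b
    proof -
      obtain r where "coord b (U (1 \<otimes> e)) = r *\<^sub>R 1"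
        using coord_jmodule_hom_center[OF U, of b e] assms by (auto simp: trivial_center_def)
      then show ?thesis
        by (simp add: along_nabla0_tensor linear_scale[OF linear_along_nabla0] der_apply_one
            tensor_bilinear)
    qed
    have "along nabla0 X (\<Sum>b\<in>B. coord b (U (1 \<otimes> e)) \<otimes> b) = 0"
      by (simp add: linear_sum[OF linear_along_nabla0] zero)
    then show ?thesis
      by (simp add: coord_expansion)
  qed
  have commute: "U (along nabla0 X m) = along nabla0 X (U m)" for m
  proof (induction m rule: tensor_induct)
    case (tensor x e)
    have "along nabla0 X (U (x \<otimes> e)) = free_smult (der_apply X x) (U (1 \<otimes> e))"
      by (subst jmodule_hom_tensor[OF U])
         (simp add: along_nabla0_Leibniz const linear_0[OF linear_free_smult])
    also have "\<dots> = U (along nabla0 X (x \<otimes> e))"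
      by (simp add: along_nabla0_tensor jmodule_hom_tensor[OF U, of "der_apply X x"])
    finally show ?case by simp
  qed (simp add: linear_add[OF lin] linear_add[OF linear_along_nabla0])
  show "U \<circ> along nabla0 X \<circ> inv U = along nabla0 X"
    using \<open>bij U\<close> by (simp add: fun_eq_iff commute bij_is_surj surj_f_inv_f)
qed

section \<open>Connections as translates of the canonical one\<close>

text \<open>The form is \<open>A m = (\<Sum>b\<in>B. \<omega>\<^sub>b \<otimes> b)\<close>, where \<open>\<omega>\<^sub>b\<close> sends \<open>X\<close> to the \<open>b\<close>-th coordinate of \<open>D X m\<close>. Here
  the finiteness of the frame is essential: a family of endomorphisms could otherwise
  involve infinitely many basis vectors as \<open>X\<close> varies.\<close>

lemma (in dual_frame) one_form_of_family:
  fixes D :: "'j::jordan_algebra der \<Rightarrow> ('j, 'e) tensor \<Rightarrow> ('j, 'e) tensor"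
  assumes hom: "\<And>X. jmodule_hom free_smult free_smult (D X)"
    and lin: "\<And>m. linear (\<lambda>X. D X m)"
    and center: "\<And>z X m. D (center_der z X) m = free_smult (of_center z) (D X m)"
  shows "\<exists>A. jmodule_hom free_smult omega1_free_smult A \<and> along A = D"
proof -
  define w where "w b m = Omega1 (\<lambda>X. coord b (D X m))" for b m
  have w: "omega1_apply (w b m) X = coord b (D X m)" for b m X
  proof -
    have "linear (\<lambda>X. coord b (D X m))"
      using linear_compose[OF lin linear_coord] by (simp add: o_def)
    then show ?thesis
      unfolding w_def by (subst Omega1_inverse) (simp_all add: center coord_free_smult)
  qed
  have D: "linear (D X)" "D X (free_smult x m) = free_smult x (D X m)" for X x m
    using hom[of X] by (auto simp: jmodule_hom_def)
  have w_add: "w b (m + m') = w b m + w b m'" for b m m'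
    by (simp add: omega1_apply_inject[symmetric] fun_eq_iff plus_omega1.rep_eq w
        linear_add[OF D(1)] linear_add[OF linear_coord])
  have w_scale: "w b (r *\<^sub>R m) = r *\<^sub>R w b m" for b r m
    by (simp add: omega1_apply_inject[symmetric] fun_eq_iff scaleR_omega1.rep_eq w
        linear_scale[OF D(1)] linear_scale[OF linear_coord])
  have w_smult: "w b (free_smult x m) = omega1_smult x (w b m)" for b x m
    by (simp add: omega1_apply_inject[symmetric] fun_eq_iff omega1_smult.rep_eq w D(2)
        coord_free_smult)
  define A where "A m = (\<Sum>b\<in>B. w b m \<otimes> b)" for m
  have "linear A"
    by (rule linearI)
       (simp_all add: A_def w_add w_scale tensor_bilinear sum.distrib scaleR_sum_right)
  moreover have "A (free_smult x m) = omega1_free_smult x (A m)" for x m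
    by (simp add: A_def w_smult linear_sum[OF linear_omega1_free_smult] omega1_free_smult_tensor)
  moreover have "along A X m = D X m" for X m
    by (simp add: along_def A_def linear_sum[OF linear_eval_at] eval_at_tensor w coord_expansion)
  ultimately show ?thesis
    by (intro exI[of _ A]) (auto simp: jmodule_hom_def fun_eq_iff)
qed

lemma (in dual_frame) der_connection_iff:
  fixes N :: "'j::jordan_algebra der \<Rightarrow> ('j, 'e) tensor \<Rightarrow> ('j, 'e) tensor"
  shows "der_connection free_smult N \<longleftrightarrow>
    (\<exists>A. jmodule_hom free_smult omega1_free_smult A \<and> N = along (nabla A))"
proof
  assume N: "der_connection free_smult N"
  define D where "D X m = N X m - along nabla0 X m" for X m
  have "jmodule_hom free_smult free_smult (D X)" for X
    using linear_compose_sub[OF _ linear_along_nabla0, of "N X" X] N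
    by (simp add: jmodule_hom_def der_connection_def D_def[abs_def] along_nabla0_Leibniz
        linear_diff[OF linear_free_smult])
  moreover have "linear (\<lambda>X. D X m)" for m
    using linear_compose_sub[OF _ linear_along_der, of "\<lambda>X. N X m" nabla0 m] N
    by (simp add: der_connection_def D_def)
  moreover have "D (center_der z X) m = free_smult (of_center z) (D X m)" for z X m
    using N by (simp add: der_connection_def D_def along_center_der linear_diff[OF linear_free_smult])
  ultimately obtain A where A: "jmodule_hom free_smult omega1_free_smult A" "along A = D"
    using one_form_of_family by blast
  have "N = along (nabla A)"
    by (simp add: fun_eq_iff along_nabla A(2) D_def)
  with A(1) show "\<exists>A. jmodule_hom free_smult omega1_free_smult A \<and> N = along (nabla A)"
    by blast
qed (auto intro: der_connection_nabla)

section \<open>Endomorphisms with central coefficients\<close>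

lemma linear_endo_apply: "linear (endo_apply T)"
  using endo_apply[of T] by simp

lemma endo_apply_sum: "endo_apply (\<Sum>i\<in>S. f i) e = (\<Sum>i\<in>S. endo_apply (f i) e)"
  by (induction S rule: infinite_finite_induct) (simp_all add: zero_endo.rep_eq plus_endo.rep_eq)

lemma center_endo_inner_bilinear:
  "bilinear (\<lambda>x e. (of_center z * x) \<otimes> endo_apply T e)"
  by (rule bilinear_tensor_map[OF linear_jordan_mult linear_endo_apply])

lemma center_endo_outer_bilinear:
  "bilinear (\<lambda>z T. tensor_lift (\<lambda>x e. (of_center z * x) \<otimes> endo_apply T e) m)"
  unfolding bilinear_def
proof (intro conjI allI linear_tensor_lift_param center_endo_inner_bilinear)
  show "linear (\<lambda>T. (of_center z * a) \<otimes> endo_apply T b)" for z a b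
    by (simp add: linear_iff plus_endo.rep_eq scaleR_endo.rep_eq tensor_bilinear)
  show "linear (\<lambda>z. (of_center z * a) \<otimes> endo_apply T b)" for T a b
    by (simp add: linear_iff plus_center.rep_eq scaleR_center.rep_eq tensor_bilinear jordan_bilinear)
qed

lemma center_endo_act_pure:
  "center_endo_act (z \<otimes> T) = tensor_lift (\<lambda>x e. (of_center z * x) \<otimes> endo_apply T e)"
  unfolding center_endo_act_def
  by (rule ext, rule tensor_lift_tensor[OF center_endo_outer_bilinear])

lemma center_endo_act_tensor:
  "center_endo_act (z \<otimes> T) (x \<otimes> e) = (of_center z * x) \<otimes> endo_apply T e"
  by (simp add: center_endo_act_pure tensor_lift_tensor center_endo_inner_bilinear)

lemma linear_center_endo_act_left: "linear (\<lambda>a. center_endo_act a m)"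
  unfolding center_endo_act_def by (rule linear_tensor_lift[OF center_endo_outer_bilinear])

lemma center_endo_act_add_left:
  "center_endo_act (a + b) m = center_endo_act a m + center_endo_act b m"
  using linear_add[OF linear_center_endo_act_left] .

lemma linear_center_endo_act: "linear (center_endo_act a)"
proof (induction a rule: tensor_induct)
  case (tensor z T)
  show ?case
    by (simp add: center_endo_act_pure linear_tensor_lift center_endo_inner_bilinear)
next
  case (add a b)
  then show ?case
    using linear_compose_add[OF add] by (simp add: center_endo_act_add_left[abs_def])
qed

lemma der_center_endo_bilinear:
  "bilinear (\<lambda>z T. der_center X z \<otimes> T :: ('j::jordan_algebra center, 'e::real_vector endo) tensor)"
proof -
  have "linear (der_center X)"
    by (rule linearI)
       (simp_all add: of_center_inject[symmetric] der_center.rep_eq plus_center.rep_eq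
         scaleR_center.rep_eq linear_add[OF linear_der_apply] linear_scale[OF linear_der_apply])
  then show ?thesis
    by (rule bilinear_tensor_map[OF _ linear_ident])
qed

lemma der_center_endo_tensor: "der_center_endo X (z \<otimes> T) = der_center X z \<otimes> T"
  by (simp add: der_center_endo_def tensor_lift_tensor der_center_endo_bilinear)

lemma linear_der_center_endo: "linear (der_center_endo X)"
  unfolding der_center_endo_def by (rule linear_tensor_lift[OF der_center_endo_bilinear])

text \<open>The product rule for the action of \<open>Z(J) \<otimes> End(E)\<close>; it computes the mixed commutators of \<open>\<nabla>\<^sup>0\<close>
  and \<open>A\<close> in the curvature.\<close>

lemma along_nabla0_center_endo_act:
  "along nabla0 X (center_endo_act a m) =
    center_endo_act (der_center_endo X a) m + center_endo_act a (along nabla0 X m)"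
proof (induction a rule: tensor_induct)
  case (tensor z T)
  show ?case
  proof (induction m rule: tensor_induct)
    case (tensor x e)
    then show ?case
      by (simp add: center_endo_act_tensor along_nabla0_tensor der_center_endo_tensor
          der_center.rep_eq der_apply_mult tensor_bilinear)
  qed (simp add: linear_add[OF linear_center_endo_act] linear_add[OF linear_along_nabla0])
qed (simp add: center_endo_act_add_left linear_add[OF linear_along_nabla0]
      linear_add[OF linear_der_center_endo])

lemma curvature_center_endo_form:
  assumes "center_endo_form A \<alpha>"
  shows "curvature (along (nabla A)) X Y m =
    center_endo_act (der_center_endo X (\<alpha> Y)) m
    - center_endo_act (der_center_endo Y (\<alpha> X)) m
    + commutator (center_endo_act (\<alpha> X)) (center_endo_act (\<alpha> Y)) m
    - center_endo_act (\<alpha> (der_bracket X Y)) m"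
proof -
  have N: "along (nabla A) X m = along nabla0 X m + center_endo_act (\<alpha> X) m" for X m
    using assms by (simp add: along_nabla center_endo_form_def)
  show ?thesis
    using curvature_nabla0[of X Y m]
    by (simp add: curvature_def commutator_def N linear_add[OF linear_along_nabla0]
        linear_add[OF linear_center_endo_act] along_nabla0_center_endo_act algebra_simps)
qed

context dual_frame
begin

definition matrix_unit :: "'e \<Rightarrow> 'e \<Rightarrow> 'e endo"
  where "matrix_unit b' b = Endo (\<lambda>e. c b e *\<^sub>R b')"

lemma matrix_unit_apply: "endo_apply (matrix_unit b' b) e = c b e *\<^sub>R b'"
proof -
  have "linear (\<lambda>e. c b e *\<^sub>R b')"
    using linear_coefficient[of b] by (simp add: linear_iff algebra_simps)
  then show ?thesis
    unfolding matrix_unit_def by (subst Endo_inverse) simp_all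
qed

lemma matrix_unit_expansion:
  "(\<Sum>b\<in>B. \<Sum>b'\<in>B. c b' (endo_apply T b) *\<^sub>R matrix_unit b' b) = T" (is "?S = T")
proof -
  have "endo_apply ?S e = endo_apply T e" for e
  proof -
    have "endo_apply ?S e = (\<Sum>b\<in>B. c b e *\<^sub>R (\<Sum>b'\<in>B. c b' (endo_apply T b) *\<^sub>R b'))"
      by (simp add: endo_apply_sum scaleR_endo.rep_eq matrix_unit_apply scaleR_sum_right
          mult.commute)
    also have "\<dots> = endo_apply T (\<Sum>b\<in>B. c b e *\<^sub>R b)"
      using linear_sum[OF linear_endo_apply, of T "\<lambda>b. c b e *\<^sub>R b" B]
      by (simp add: frame_expansion linear_scale[OF linear_endo_apply])
    finally show ?thesis
      by (simp add: frame_expansion)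
  qed
  then show ?thesis
    by (simp add: endo_apply_inject[symmetric] fun_eq_iff)
qed

definition center_entry ::
    "'e \<Rightarrow> 'e \<Rightarrow> ('j::jordan_algebra center, 'e endo) tensor \<Rightarrow> 'j center"
  where "center_entry b' b = tensor_lift (\<lambda>z T. c b' (endo_apply T b) *\<^sub>R z)"

lemma center_entry_bilinear: "bilinear (\<lambda>z T. c b' (endo_apply T b) *\<^sub>R z)"
  using linear_coefficient[of b']
  by (simp add: bilinear_def linear_iff plus_endo.rep_eq scaleR_endo.rep_eq algebra_simps)

lemma center_entry_tensor: "center_entry b' b (z \<otimes> T) = c b' (endo_apply T b) *\<^sub>R z"
  unfolding center_entry_def by (rule tensor_lift_tensor[OF center_entry_bilinear])

lemma linear_center_entry: "linear (center_entry b' b)"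
  unfolding center_entry_def by (rule linear_tensor_lift[OF center_entry_bilinear])

lemma center_entry_expansion:
  "(\<Sum>b\<in>B. \<Sum>b'\<in>B. center_entry b' b a \<otimes> matrix_unit b' b) = a"
proof (induction a rule: tensor_induct)
  case (tensor z T)
  have "(\<Sum>b\<in>B. \<Sum>b'\<in>B. center_entry b' b (z \<otimes> T) \<otimes> matrix_unit b' b)
      = z \<otimes> (\<Sum>b\<in>B. \<Sum>b'\<in>B. c b' (endo_apply T b) *\<^sub>R matrix_unit b' b)"
    by (simp add: center_entry_tensor tensor_bilinear linear_sum[OF linear_tensor_right])
  then show ?case
    by (simp add: matrix_unit_expansion)
qed (simp add: linear_add[OF linear_center_entry] tensor_bilinear sum.distrib)

text \<open>The entries of an element of \<open>Z(J) \<otimes> End(E)\<close> can be read off from its action, hence the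
  action is faithful.\<close>

lemma of_center_center_entry:
  fixes a :: "('j::unital_jordan_algebra center, 'e endo) tensor"
  shows "of_center (center_entry b' b a) = coord b' (center_endo_act a (1 \<otimes> b))"
  by (induction a rule: tensor_induct)
     (simp_all add: center_entry_tensor center_endo_act_tensor coord_tensor jordan_one_right
       scaleR_center.rep_eq plus_center.rep_eq linear_add[OF linear_center_entry]
       linear_add[OF linear_coord] center_endo_act_add_left)

lemma center_endo_act_inject:
  fixes a a' :: "('j::unital_jordan_algebra center, 'e endo) tensor"
  assumes "\<And>m. center_endo_act a m = center_endo_act a' m"
  shows "a = a'"
proof -
  have "center_entry b' b a = center_entry b' b a'" for b b'
    using assms by (simp add: of_center_inject[symmetric] of_center_center_entry)
  then show ?thesis
    by (metis (no_types, lifting) center_entry_expansion sum.cong)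
qed

text \<open>The matrix of \<open>U\<close> has the coordinates of \<open>U (1 \<otimes> b)\<close> as its column at \<open>b\<close>; these are central,
  so the matrix is an element of \<open>Z(J) \<otimes> End(E)\<close>.\<close>

lemma jmodule_hom_eq_center_endo_act:
  fixes U :: "('j::unital_jordan_algebra, 'e) tensor \<Rightarrow> ('j, 'e) tensor"
  assumes U: "jmodule_hom free_smult free_smult U"
  shows "\<exists>a. \<forall>m. U m = center_endo_act a m"
proof -
  define z where "z b' b = Center (coord b' (U (1 \<otimes> b)))" for b b'
  have z: "of_center (z b' b) = coord b' (U (1 \<otimes> b))" for b b'
    unfolding z_def by (rule Center_inverse[OF coord_jmodule_hom_center[OF U]])
  have lin: "linear U"
    using U by (simp add: jmodule_hom_def)
  define a where "a = (\<Sum>b\<in>B. \<Sum>b'\<in>B. z b' b \<otimes> matrix_unit b' b)"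
  have "U m = center_endo_act a m" for m
  proof (induction m rule: tensor_induct)
    case (tensor x e)
    have column: "(\<Sum>b'\<in>B. (of_center (z b' b) * x) \<otimes> b') = U (x \<otimes> b)" for b
    proof -
      have "of_center (z b' b) * x = coord b' (U (x \<otimes> b))" for b'
        by (simp add: z jmodule_hom_tensor[OF U, of x] coord_free_smult jordan_commute)
      then show ?thesis
        by (simp add: coord_expansion)
    qed
    have "x \<otimes> e = (\<Sum>b\<in>B. c b e *\<^sub>R (x \<otimes> b))"
      using linear_sum[OF linear_tensor_right, of x "\<lambda>b. c b e *\<^sub>R b" B]
      by (simp add: frame_expansion tensor_bilinear)
    then have "U (x \<otimes> e) = (\<Sum>b\<in>B. c b e *\<^sub>R U (x \<otimes> b))"
      by (simp add: linear_sum[OF lin] linear_scale[OF lin])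
    also have "\<dots> = center_endo_act a (x \<otimes> e)"
      by (simp add: a_def linear_sum[OF linear_center_endo_act_left] center_endo_act_tensor
          matrix_unit_apply tensor_bilinear column[symmetric] scaleR_sum_right)
    finally show ?case .
  qed (simp add: linear_add[OF lin] linear_add[OF linear_center_endo_act])
  then show ?thesis by blast
qed

lemma center_endo_form_ex1:
  fixes A :: "('j::unital_jordan_algebra, 'e) tensor \<Rightarrow> ('j omega1, 'e) tensor"
  assumes "jmodule_hom free_smult omega1_free_smult A"
  shows "\<exists>!\<alpha>. center_endo_form A \<alpha>"
proof (rule ex_ex1I)
  have "\<forall>X. \<exists>a. \<forall>m. along A X m = center_endo_act a m"
    using jmodule_hom_eq_center_endo_act[OF jmodule_hom_along[OF assms]] by blast
  then show "\<exists>\<alpha>. center_endo_form A \<alpha>"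
    unfolding center_endo_form_def by (rule choice)
next
  fix \<alpha> \<beta>
  assume "center_endo_form A \<alpha>" "center_endo_form A \<beta>"
  then have "center_endo_act (\<alpha> X) m = center_endo_act (\<beta> X) m" for X m
    by (simp add: center_endo_form_def)
  then show "\<alpha> = \<beta>"
    using center_endo_act_inject by blast
qed

end

section \<open>Connection forms with values in \<open>End(E)\<close>\<close>

lemma one_in_jordan_center: "(1::'j::unital_jordan_algebra) \<in> jordan_center"
  by (rule jordan_centerI) (simp add: jordan_one_right)

text \<open>If the central factor is \<open>r 1\<close>, the scalar \<open>r\<close> can be moved across the tensor sign.\<close>

lemma trivial_center_endo:
  fixes a :: "('j::unital_jordan_algebra center, 'e::real_vector endo) tensor"
  assumes "trivial_center TYPE('j)"
  shows "\<exists>T. a = Center 1 \<otimes> T"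
proof (induction a rule: tensor_induct)
  case (tensor z T)
  obtain r where "of_center z = r *\<^sub>R 1"
    using assms of_center[of z] by (auto simp: trivial_center_def)
  then have "z = r *\<^sub>R Center 1"
    by (simp add: of_center_inject[symmetric] scaleR_center.rep_eq Center_inverse
        one_in_jordan_center)
  then have "z \<otimes> T = Center 1 \<otimes> (r *\<^sub>R T)"
    by (simp add: tensor_bilinear)
  then show ?case by blast
next
  case (add a b)
  then show ?case
    by (metis tensor_bilinear(2))
qed

lemma simple_jordan_one_neq_zero:
  assumes "simple_jordan TYPE('j::unital_jordan_algebra)"
  shows "(1::'j) \<noteq> 0"
proof
  assume "(1::'j) = 0"
  then have "x = 0" for x :: 'j
    using jordan_one_left[of x] by (simp add: jordan_zero_left)
  then have "(UNIV :: 'j set) = {0}" by auto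
  then show False
    using assms by (simp add: simple_jordan_def)
qed

context dual_frame
begin

lemma one_tensor_inject:
  fixes e e' :: 'e
  assumes "(1::'j::unital_jordan_algebra) \<noteq> 0" "(1::'j) \<otimes> e = 1 \<otimes> e'"
  shows "e = e'"
proof -
  have "c b e *\<^sub>R (1::'j) = c b e' *\<^sub>R 1" for b
    using arg_cong[OF assms(2), of "coord b"] by (simp add: coord_tensor)
  then have "c b e = c b e'" for b
    using assms(1) by simp
  then show ?thesis
    by (metis (no_types, lifting) frame_expansion sum.cong)
qed

lemma endo_form_ex1:
  fixes A :: "('j::unital_jordan_algebra, 'e) tensor \<Rightarrow> ('j omega1, 'e) tensor"
  assumes "jmodule_hom free_smult omega1_free_smult A"
    and "trivial_center TYPE('j)" and "(1::'j) \<noteq> 0"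
  shows "\<exists>!T. endo_form A T"
proof (rule ex_ex1I)
  have "\<exists>T. \<forall>x e. along A X (x \<otimes> e) = x \<otimes> endo_apply T e" for X
  proof -
    obtain a where a: "along A X m = center_endo_act a m" for m
      using jmodule_hom_eq_center_endo_act[OF jmodule_hom_along[OF assms(1)]] by blast
    obtain T where "a = Center 1 \<otimes> T"
      using trivial_center_endo[OF assms(2)] by blast
    then show ?thesis
      by (intro exI[of _ T]) (simp add: a center_endo_act_tensor Center_inverse
          one_in_jordan_center jordan_one_left)
  qed
  then show "\<exists>T. endo_form A T"
    unfolding endo_form_def by (intro choice) blast
next
  fix S T
  assume ST: "endo_form A S" "endo_form A T"
  have "endo_apply (S X) e = endo_apply (T X) e" for X e
    by (rule one_tensor_inject[OF assms(3)]) (use ST in \<open>metis endo_form_def\<close>)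
  then show "S = T"
    by (simp add: fun_eq_iff endo_apply_inject[symmetric])
qed

text \<open>Linearity of \<open>T\<close> is inherited from that of one-forms, so only compatibility with brackets is
  at stake; the curvature of \<open>1 \<otimes> e\<close> detects it.\<close>

lemma flat_iff_lie_hom:
  fixes A :: "('j::unital_jordan_algebra, 'e) tensor \<Rightarrow> ('j omega1, 'e) tensor"
  assumes "jmodule_hom free_smult omega1_free_smult A"
    and T: "endo_form A T" and one: "(1::'j) \<noteq> 0"
  shows "flat (along (nabla A)) \<longleftrightarrow> der_endo_lie_hom T"
proof -
  have A: "along A X (x \<otimes> e) = x \<otimes> endo_apply (T X) e" for X x e
    using T by (simp add: endo_form_def)
  have linA: "linear (along A X)" for X
    using jmodule_hom_along[OF assms(1)] by (simp add: jmodule_hom_def)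
  have curv: "curvature (along (nabla A)) X Y (x \<otimes> e) =
      x \<otimes> (endo_apply (endo_bracket (T X) (T Y)) e - endo_apply (T (der_bracket X Y)) e)" for X Y x e
    by (simp add: curvature_def commutator_def along_nabla A along_nabla0_tensor
        linear_add[OF linA] linear_add[OF linear_along_nabla0] tensor_bilinear
        der_bracket.rep_eq endo_bracket.rep_eq algebra_simps)
  have "linear T"
  proof (rule linearI)
    fix X Y
    have "(1::'j) \<otimes> endo_apply (T (X + Y)) e = 1 \<otimes> endo_apply (T X + T Y) e" for e
      using linear_add[OF linear_along_der, of A X Y "1 \<otimes> e"]
      by (simp add: A plus_endo.rep_eq tensor_bilinear)
    then show "T (X + Y) = T X + T Y"
      using one_tensor_inject[OF one] by (simp add: endo_apply_inject[symmetric] fun_eq_iff)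
  next
    fix r X
    have "(1::'j) \<otimes> endo_apply (T (r *\<^sub>R X)) e = 1 \<otimes> endo_apply (r *\<^sub>R T X) e" for e
      using linear_scale[OF linear_along_der, of A r X "1 \<otimes> e"]
      by (simp add: A scaleR_endo.rep_eq tensor_bilinear)
    then show "T (r *\<^sub>R X) = r *\<^sub>R T X"
      using one_tensor_inject[OF one] by (simp add: endo_apply_inject[symmetric] fun_eq_iff)
  qed
  moreover have "flat (along (nabla A)) \<longleftrightarrow>
      (\<forall>X Y. T (der_bracket X Y) = endo_bracket (T X) (T Y))"
  proof (intro iffI allI)
    fix X Y
    assume "flat (along (nabla A))"
    then have "(1::'j) \<otimes> (endo_apply (endo_bracket (T X) (T Y)) e
        - endo_apply (T (der_bracket X Y)) e) = 1 \<otimes> 0" for e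
      using curv[of X Y 1 e] by (simp add: flat_def tensor_bilinear(8))
    then have "endo_apply (endo_bracket (T X) (T Y)) e = endo_apply (T (der_bracket X Y)) e" for e
      using one_tensor_inject[OF one] by fastforce
    then show "T (der_bracket X Y) = endo_bracket (T X) (T Y)"
      by (simp add: endo_apply_inject[symmetric] fun_eq_iff)
  next
    assume hom: "\<forall>X Y. T (der_bracket X Y) = endo_bracket (T X) (T Y)"
    have lin: "linear (along (nabla A) X)" for X
      using der_connection_nabla[OF assms(1)] by (simp add: der_connection_def)
    have "curvature (along (nabla A)) X Y m = 0" for X Y m
    proof (induction m rule: tensor_induct)
      case (tensor x e)
      show ?case
        by (simp add: curv hom tensor_bilinear(8))
    next
      case (add s t)
      have "curvature (along (nabla A)) X Y (s + t)
          = curvature (along (nabla A)) X Y s + curvature (along (nabla A)) X Y t"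
        by (simp add: curvature_def commutator_def linear_add[OF lin])
      with add show ?case by simp
    qed
    then show "flat (along (nabla A))"
      by (simp add: flat_def)
  qed
  ultimately show ?thesis
    by (simp add: der_endo_lie_hom_def)
qed

end

theorem proposition6p8:
  assumes "finite_dim TYPE('j::unital_jordan_algebra)"
    and "finite_dim TYPE('e::real_vector)"
  shows
    "(let N0 = along (nabla0 :: ('j, 'e) tensor \<Rightarrow> ('j omega1, 'e) tensor) in
        der_connection free_smult N0 \<and> flat N0 \<and>
        (trivial_center TYPE('j) \<longrightarrow> gauge_invariant free_smult N0))
     \<and>
     (\<forall>N :: 'j der \<Rightarrow> ('j, 'e) tensor \<Rightarrow> ('j, 'e) tensor.
        der_connection free_smult N \<longleftrightarrow>
        (\<exists>A. jmodule_hom free_smult omega1_free_smult A \<and> N = along (nabla A)))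
     \<and>
     (\<forall>A :: ('j, 'e) tensor \<Rightarrow> ('j omega1, 'e) tensor.
        jmodule_hom free_smult omega1_free_smult A \<and>
        der_connection free_smult (along (nabla A)) \<longrightarrow>
        (\<exists>!\<alpha>. center_endo_form A \<alpha>) \<and>
        (\<forall>\<alpha>. center_endo_form A \<alpha> \<longrightarrow>
          (\<forall>X Y m. curvature (along (nabla A)) X Y m =
             center_endo_act (der_center_endo X (\<alpha> Y)) m
             - center_endo_act (der_center_endo Y (\<alpha> X)) m
             + commutator (center_endo_act (\<alpha> X)) (center_endo_act (\<alpha> Y)) m
             - center_endo_act (\<alpha> (der_bracket X Y)) m)))
     \<and>
     (simple_jordan TYPE('j) \<longrightarrow>
       (\<forall>A :: ('j, 'e) tensor \<Rightarrow> ('j omega1, 'e) tensor.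
          jmodule_hom free_smult omega1_free_smult A \<and>
          der_connection free_smult (along (nabla A)) \<longrightarrow>
          (trivial_center TYPE('j) \<longrightarrow> (\<exists>!T. endo_form A T)) \<and>
          (\<forall>T. endo_form A T \<longrightarrow> (flat (along (nabla A)) \<longleftrightarrow> der_endo_lie_hom T))))"
proof -
  obtain B :: "'e set" and c where "dual_frame B c"
    using dual_frame_exists[OF assms(2)] by blast
  then interpret dual_frame B c .
  show ?thesis
    unfolding Let_def
  proof (intro conjI allI impI)
    let ?N0 = "along (nabla0 :: ('j, 'e) tensor \<Rightarrow> ('j omega1, 'e) tensor)"
    show "der_connection free_smult ?N0"
      by (rule der_connection_nabla0)
    show "flat ?N0"
      by (simp add: flat_def curvature_nabla0)
    show "gauge_invariant free_smult ?N0" if "trivial_center TYPE('j)"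
      using that by (rule gauge_invariant_nabla0)
    show "der_connection free_smult N \<longleftrightarrow>
        (\<exists>A. jmodule_hom free_smult omega1_free_smult A \<and> N = along (nabla A))"
      for N :: "'j der \<Rightarrow> ('j, 'e) tensor \<Rightarrow> ('j, 'e) tensor"
      by (rule der_connection_iff)
  next
    fix A :: "('j, 'e) tensor \<Rightarrow> ('j omega1, 'e) tensor"
    assume "jmodule_hom free_smult omega1_free_smult A \<and>
      der_connection free_smult (along (nabla A))"
    then have A: "jmodule_hom free_smult omega1_free_smult A" by simp
    show "\<exists>!\<alpha>. center_endo_form A \<alpha>"
      by (rule center_endo_form_ex1[OF A])
    show "curvature (along (nabla A)) X Y m =
        center_endo_act (der_center_endo X (\<alpha> Y)) m
        - center_endo_act (der_center_endo Y (\<alpha> X)) m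
        + commutator (center_endo_act (\<alpha> X)) (center_endo_act (\<alpha> Y)) m
        - center_endo_act (\<alpha> (der_bracket X Y)) m"
      if "center_endo_form A \<alpha>" for \<alpha> X Y m
      using that by (rule curvature_center_endo_form)
    assume "simple_jordan TYPE('j)"
    then have one: "(1::'j) \<noteq> 0"
      by (rule simple_jordan_one_neq_zero)
    show "\<exists>!T. endo_form A T" if "trivial_center TYPE('j)"
      using endo_form_ex1[OF A that one] .
    show "flat (along (nabla A)) \<longleftrightarrow> der_endo_lie_hom T" if "endo_form A T" for T
      by (rule flat_iff_lie_hom[OF A that one])
  qed
qed

end
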